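(* Let $c\in(0,1)$ and let $f:\mathbb{Z}^{+}\to\mathbb{R}^{+}$ be a function such that $f(n)$ is $\Theta(n^c)$. Then, as $n\to\infty$: if $c\le\frac23$, $\gamma(n,f)$ is $\Theta(n^{1-\frac{c}{2}})$; and if $c\ge\frac23$, $\gamma(n,f)$ is $\Omega(n^{2-2c})$.
   Context: Graphs are finite and simple. A book of size $q$ in a graph is a set of $q$ triangles sharing a common edge. $bk(G)$ denotes the size of the largest book in $G$, i.e. the maximum over edges $e$ of $G$ of the number of triangles of $G$ containing $e$ ($0$ if $G$ has no edges). For a function $f:\mathbb{Z}^{+}\to\mathbb{R}^{+}$, $\gamma(n,f)$ is the minimal value of $bk(G)$ over all graphs $G$ with $n$ vertices and at least $\left\lceil\frac{n^2}{4}-nf(n)\right\rceil$ edges such that every edge of $G$ is contained in at least one triangle. The implied constants in $\Theta$ and $\Omega$ may depend on $c$ and $f$ but not on $n$. *)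

theory Defs
  imports Complex_Main "HOL-Library.Landau_Symbols"
begin

definition simple_graph :: "'a set \<Rightarrow> 'a set set \<Rightarrow> bool" where
  "simple_graph V E \<longleftrightarrow> finite V \<and> (\<forall>e\<in>E. e \<subseteq> V \<and> card e = 2)"

definition triangles :: "'a set set \<Rightarrow> 'a set set" where
  "triangles E = {T. card T = 3 \<and> (\<forall>e. e \<subseteq> T \<and> card e = 2 \<longrightarrow> e \<in> E)}"

definition triangles_on :: "'a set set \<Rightarrow> 'a set \<Rightarrow> 'a set set" where
  "triangles_on E e = {T \<in> triangles E. e \<subseteq> T}"

definition bk :: "'a set set \<Rightarrow> nat" where
  "bk E = (if E = {} then 0 else Max ((\<lambda>e. card (triangles_on E e)) ` E))"

definition admissible :: "nat \<Rightarrow> (nat \<Rightarrow> real) \<Rightarrow> nat set \<Rightarrow> nat set set \<Rightarrow> bool" where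
  "admissible n f V E \<longleftrightarrow>
     simple_graph V E \<and> card V = n \<and>
     int (card E) \<ge> \<lceil>(real n)\<^sup>2 / 4 - real n * f n\<rceil> \<and>
     (\<forall>e\<in>E. triangles_on E e \<noteq> {})"

text \<open>
  Every finite graph is isomorphic to one on natural numbers, so fixing the vertex type loses
  nothing. For \<open>n \<ge> 3\<close> and \<open>f n > 0\<close> the complete graph is admissible, hence the minimum
  exists; for \<open>n < 3\<close> there may be no admissible graph and the value is then unspecified, which
  does not matter for the behaviour as \<open>n\<close> tends to infinity.
\<close>
definition gamma :: "nat \<Rightarrow> (nat \<Rightarrow> real) \<Rightarrow> nat" where
  "gamma n f = (LEAST q. \<exists>V E. admissible n f V E \<and> bk E = q)"

end

theory Submission
  imports Defs
begin

text \<open>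
  Lower bound. If the largest book has size \<open>q \<le> n / 100\<close>, the degrees in a triangle sum to at most
  \<open>n + 3 q\<close>, so the set \<open>S\<close> of vertices of degree at most \<open>2 n / 5\<close> meets every triangle. Hence
  there are few triangles, and the identity for the sums of degrees and of squared degrees yields
  \<open>|S| = O(f)\<close> and shows that a typical edge \<open>xy\<close> leaves only \<open>O(f)\<close> vertices undominated. A
  typical edge avoids \<open>S\<close>, so it lies in a triangle with some \<open>z \<in> S\<close>; as \<open>x\<close> and \<open>y\<close> each have at
  most \<open>q\<close> common neighbours with \<open>z\<close>, the degree of \<open>z\<close> is at most \<open>2 q + O(f)\<close>, and \<open>z\<close> covers
  at most \<open>q (2 q + O(f))\<close> edges. Therefore \<open>n\<^sup>2 = O(f q (q + f))\<close>, that is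
  \<open>q = \<Omega>(min (n / sqrt f) (n\<^sup>2 / f\<^sup>2))\<close>.

  Upper bound. Split both sides of a balanced complete bipartite graph into \<open>k \<approx> sqrt f\<close> classes and
  add \<open>k\<^sup>2 \<le> f\<close> hubs, one joined to each pair of classes from opposite sides. Books then have size
  about \<open>n / (2 k)\<close>.
\<close>

section \<open>Neighbourhoods, triangles and books in a simple graph\<close>

definition nbrs :: "'a set set \<Rightarrow> 'a \<Rightarrow> 'a set" where
  "nbrs E x = {y. {x, y} \<in> E}"

lemma nbrs_sym: "y \<in> nbrs E x \<longleftrightarrow> x \<in> nbrs E y"
  by (simp add: nbrs_def insert_commute)

context
  fixes V :: "'a set" and E :: "'a set set"
  assumes graph: "simple_graph V E"
begin

lemma finite_V: "finite V"
  using graph by (simp add: simple_graph_def)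

lemma finite_E: "finite E"
proof -
  have "E \<subseteq> Pow V"
    using graph by (auto simp: simple_graph_def)
  then show ?thesis
    using finite_V finite_subset by blast
qed

lemma nbrs_subset: "nbrs E x \<subseteq> V"
  using graph by (auto simp: simple_graph_def nbrs_def)

lemma nbrs_in_V: "y \<in> nbrs E x \<Longrightarrow> x \<in> V" "y \<in> nbrs E x \<Longrightarrow> y \<in> V"
  using nbrs_subset nbrs_sym by fast+

lemma nbrs_irrefl: "x \<notin> nbrs E x"
  using graph by (force simp: simple_graph_def nbrs_def)

lemma finite_nbrs [simp]: "finite (nbrs E x)"
  using nbrs_subset finite_V finite_subset by blast

text \<open>Lets books be measured by common neighbourhoods: a triangle on an edge is determined by
  its third vertex.\<close>

lemma triangles_on_eq:
  assumes "{x, y} \<in> E"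
  shows "triangles_on E {x, y} = (\<lambda>z. {x, y, z}) ` (nbrs E x \<inter> nbrs E y)" (is "?L = ?R")
proof -
  have xy: "x \<noteq> y"
    using assms nbrs_irrefl[of x] by (auto simp: nbrs_def)
  show ?thesis
  proof (intro subset_antisym subsetI)
    fix T assume "T \<in> triangles_on E {x, y}"
    then have T: "card T = 3" "x \<in> T" "y \<in> T"
      and TE: "\<And>e. e \<subseteq> T \<Longrightarrow> card e = 2 \<Longrightarrow> e \<in> E"
      by (auto simp: triangles_on_def triangles_def)
    have "card (T - {x, y}) = 1"
      using T xy by (subst card_Diff_subset) auto
    then obtain z where z: "T - {x, y} = {z}"
      by (auto simp: card_1_singleton_iff)
    then have "T = {x, y, z}" "z \<noteq> x" "z \<noteq> y"
      using T by auto
    moreover from this have "{x, z} \<in> E" "{y, z} \<in> E"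
      using TE by auto
    ultimately show "T \<in> ?R"
      by (auto simp: nbrs_def)
  next
    fix T assume "T \<in> ?R"
    then obtain z where z: "z \<in> nbrs E x" "z \<in> nbrs E y" and T: "T = {x, y, z}"
      by auto
    have ne: "z \<noteq> x" "z \<noteq> y"
      using z nbrs_irrefl by auto
    have "e \<in> E" if "e \<subseteq> T" and two: "card e = 2" for e
    proof -
      obtain a b where "e = {a, b}" "a \<noteq> b"
        using two by (auto simp: card_2_iff)
      then show ?thesis
        using \<open>e \<subseteq> T\<close> z assms unfolding T nbrs_def by (auto simp: insert_commute)
    qed
    then show "T \<in> triangles_on E {x, y}"
      using xy ne by (auto simp: triangles_on_def triangles_def T)
  qed
qed

lemma card_triangles_on:
  assumes "{x, y} \<in> E"
  shows "card (triangles_on E {x, y}) = card (nbrs E x \<inter> nbrs E y)"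
proof -
  have "inj_on (\<lambda>z. {x, y, z}) (nbrs E x \<inter> nbrs E y)"
  proof (rule inj_onI)
    fix z w
    assume "z \<in> nbrs E x \<inter> nbrs E y" "w \<in> nbrs E x \<inter> nbrs E y" "{x, y, z} = {x, y, w}"
    then show "z = w"
      using nbrs_irrefl[of x] nbrs_irrefl[of y] by (metis IntD1 IntD2 insertE insert_iff singletonD)
  qed
  then show ?thesis
    by (simp add: triangles_on_eq[OF assms] card_image)
qed

lemma card_common_nbrs_le_bk:
  assumes "y \<in> nbrs E x"
  shows "card (nbrs E x \<inter> nbrs E y) \<le> bk E"
proof -
  have e: "{x, y} \<in> E"
    using assms by (simp add: nbrs_def)
  then have "card (triangles_on E {x, y}) \<le> Max ((\<lambda>e. card (triangles_on E e)) ` E)"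
    using finite_E by (intro Max_ge) auto
  then show ?thesis
    using e by (auto simp: bk_def card_triangles_on[OF e])
qed

lemma bk_le:
  assumes "\<And>x y. y \<in> nbrs E x \<Longrightarrow> card (nbrs E x \<inter> nbrs E y) \<le> b"
  shows "bk E \<le> b"
proof (cases "E = {}")
  case False
  have "card (triangles_on E e) \<le> b" if "e \<in> E" for e
  proof -
    have "card e = 2"
      using graph that by (auto simp: simple_graph_def)
    then obtain x y where e: "e = {x, y}"
      by (auto simp: card_2_iff)
    then show ?thesis
      using assms[of y x] that card_triangles_on[of x y] by (simp add: nbrs_def)
  qed
  then show ?thesis
    using False finite_E by (simp add: bk_def)
qed (simp add: bk_def)

section \<open>Degree sums over vertices and ordered adjacent pairs\<close>

lemma handshake: "(\<Sum>x\<in>V. card (nbrs E x)) = 2 * card E"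
proof -
  have "card (nbrs E x) = card {e \<in> E. x \<in> e}" if "x \<in> V" for x
  proof (rule bij_betw_same_card[of "\<lambda>y. {x, y}"], rule bij_betwI')
    fix e assume "e \<in> {e \<in> E. x \<in> e}"
    moreover from this have "card e = 2"
      using graph by (auto simp: simple_graph_def)
    ultimately show "\<exists>y\<in>nbrs E x. e = {x, y}"
      by (auto simp: card_2_iff nbrs_def insert_commute)
  qed (auto simp: nbrs_def doubleton_eq_iff)
  then have "(\<Sum>x\<in>V. card (nbrs E x)) = (\<Sum>x\<in>V. card {e \<in> E. x \<in> e})"
    by simp
  also have "\<dots> = 2 * card E"
  proof (rule sum_multicount[OF finite_V finite_E], rule ballI)
    fix e assume "e \<in> E"
    then have "{x \<in> V. x \<in> e} = e" "card e = 2"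
      using graph by (auto simp: simple_graph_def)
    then show "card {x \<in> V. x \<in> e} = 2"
      by simp
  qed
  finally show ?thesis .
qed

lemma sum_nbrs_swap:
  fixes g :: "'a \<Rightarrow> real"
  shows "(\<Sum>x\<in>V. \<Sum>y\<in>nbrs E x. g y) = (\<Sum>y\<in>V. real (card (nbrs E y)) * g y)"
proof -
  have *: "nbrs E x = {y \<in> V. y \<in> nbrs E x}" for x
    using nbrs_subset by auto
  have "(\<Sum>x\<in>V. \<Sum>y\<in>nbrs E x. g y) = (\<Sum>x\<in>V. \<Sum>y\<in>{y \<in> V. y \<in> nbrs E x}. g y)"
    using * by simp
  also have "\<dots> = (\<Sum>y\<in>V. \<Sum>x\<in>{x \<in> V. y \<in> nbrs E x}. g y)"
    by (rule sum.swap_restrict[OF finite_V finite_V])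
  also have "\<dots> = (\<Sum>y\<in>V. \<Sum>x\<in>nbrs E y. g y)"
    by (intro sum.cong refl) (subst nbrs_sym, rule *[symmetric])
  finally show ?thesis
    by simp
qed

lemma card_undominated:
  "real (card (V - (nbrs E x \<union> nbrs E y))) =
    real (card V) + real (card (nbrs E x \<inter> nbrs E y)) - real (card (nbrs E x)) - real (card (nbrs E y))"
proof -
  have sub: "nbrs E x \<union> nbrs E y \<subseteq> V"
    using nbrs_subset by auto
  then have "card (nbrs E x \<union> nbrs E y) \<le> card V"
    by (intro card_mono finite_V)
  moreover have "card (nbrs E x) + card (nbrs E y) =
      card (nbrs E x \<union> nbrs E y) + card (nbrs E x \<inter> nbrs E y)"
    by (rule card_Un_Int) simp_all
  ultimately show ?thesis
    using card_Diff_subset[OF _ sub] by (simp add: of_nat_diff)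
qed

text \<open>Sum \<open>card_undominated\<close> over ordered adjacent pairs; both degree terms
  become the sum of squared degrees, which completing the square around \<open>n / 2\<close>
  cancels. Both sums on the left are nonnegative, so many edges and few triangles force both to be
  small.\<close>

lemma degree_identity:
  defines "n \<equiv> real (card V)"
  shows "(\<Sum>x\<in>V. \<Sum>y\<in>nbrs E x. real (card (V - (nbrs E x \<union> nbrs E y))))
      + 2 * (\<Sum>x\<in>V. (real (card (nbrs E x)) - n / 2)\<^sup>2)
    = n * (n\<^sup>2 / 2 - 2 * real (card E)) + (\<Sum>x\<in>V. \<Sum>y\<in>nbrs E x. real (card (nbrs E x \<inter> nbrs E y)))"
proof -
  let ?d = "\<lambda>x. real (card (nbrs E x))"
  define D where "D = (\<Sum>x\<in>V. (?d x)\<^sup>2)"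
  define C where "C = (\<Sum>x\<in>V. \<Sum>y\<in>nbrs E x. real (card (nbrs E x \<inter> nbrs E y)))"
  have hs: "(\<Sum>x\<in>V. ?d x) = 2 * real (card E)"
    using arg_cong[OF handshake, of real] by simp
  have "(\<Sum>x\<in>V. \<Sum>y\<in>nbrs E x. real (card (V - (nbrs E x \<union> nbrs E y)))) =
      n * (\<Sum>x\<in>V. ?d x) + C - D - (\<Sum>x\<in>V. \<Sum>y\<in>nbrs E x. ?d y)"
    unfolding card_undominated C_def D_def n_def
    by (simp add: sum.distrib sum_subtractf sum_distrib_left power2_eq_square mult.commute)
  moreover have "(\<Sum>x\<in>V. \<Sum>y\<in>nbrs E x. ?d y) = D"
    unfolding sum_nbrs_swap D_def by (simp add: power2_eq_square)
  moreover have "(\<Sum>x\<in>V. (?d x - n / 2)\<^sup>2) = D - n * (\<Sum>x\<in>V. ?d x) + n * (n\<^sup>2 / 4)"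
    unfolding D_def n_def
    by (simp add: power2_diff sum.distrib sum_subtractf sum_distrib_left power_divide mult.commute)
  ultimately show ?thesis
    unfolding C_def[symmetric] hs by (simp add: algebra_simps)
qed

section \<open>Triangle counts and the lower bound on the largest book\<close>

lemma degree_sum_triangle:
  assumes "y \<in> nbrs E x" "z \<in> nbrs E x" "z \<in> nbrs E y"
  shows "card (nbrs E x) + card (nbrs E y) + card (nbrs E z) \<le> card V + 3 * bk E"
proof -
  let ?X = "nbrs E x" and ?Y = "nbrs E y" and ?Z = "nbrs E z"
  have "card ?X + card ?Y = card (?X \<union> ?Y) + card (?X \<inter> ?Y)"
    by (rule card_Un_Int) simp_all
  moreover have "card (?X \<union> ?Y) + card ?Z = card (?X \<union> ?Y \<union> ?Z) + card ((?X \<union> ?Y) \<inter> ?Z)"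
    by (rule card_Un_Int) simp_all
  moreover have "card ((?X \<union> ?Y) \<inter> ?Z) \<le> card (?X \<inter> ?Z) + card (?Y \<inter> ?Z)"
    unfolding Int_Un_distrib2 by (rule card_Un_le)
  moreover have "card (?X \<union> ?Y \<union> ?Z) \<le> card V"
    using nbrs_subset by (intro card_mono finite_V) auto
  \<comment> \<open>All three pairs are adjacent, so each pairwise overlap is at most
    \<open>bk E\<close>.\<close>
  ultimately show ?thesis
    using assms card_common_nbrs_le_bk[of y x] card_common_nbrs_le_bk[of z x]
      card_common_nbrs_le_bk[of z y] by linarith
qed

text \<open>There are at most \<open>b\<close> choices for \<open>x\<close> next to
  \<open>z\<close>, and the third vertex lies in the book on \<open>zx\<close>. Applied both to
  count all triangles and to count the edges covered by low-degree vertices.\<close>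

lemma card_triangles_through:
  assumes "S \<subseteq> V" and "\<And>z. z \<in> S \<Longrightarrow> real (card (nbrs E z)) \<le> b"
  shows "real (card (SIGMA z:S. SIGMA x:nbrs E z. nbrs E z \<inter> nbrs E x)) \<le> real (card S) * b * real (bk E)"
proof -
  have fin: "finite S"
    using assms(1) finite_V finite_subset by blast
  have "real (card (SIGMA z:S. SIGMA x:nbrs E z. nbrs E z \<inter> nbrs E x)) =
      (\<Sum>z\<in>S. \<Sum>x\<in>nbrs E z. real (card (nbrs E z \<inter> nbrs E x)))"
    by (simp add: card_SigmaI fin finite_SigmaI)
  also have "\<dots> \<le> (\<Sum>z\<in>S. \<Sum>x\<in>nbrs E z. real (bk E))"
    by (intro sum_mono) (use card_common_nbrs_le_bk in auto)
  also have "\<dots> = (\<Sum>z\<in>S. real (card (nbrs E z)) * real (bk E))"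
    by simp
  also have "\<dots> \<le> (\<Sum>z\<in>S. b * real (bk E))"
    by (intro sum_mono mult_right_mono assms) auto
  finally show ?thesis
    by (simp add: mult.assoc)
qed

text \<open>Every ordered triangle has a vertex in \<open>S\<close>; moving it to the front leaves a
  triple counted by \<open>card_triangles_through\<close>. The factor 3 accounts for the position it
  came from.\<close>

lemma triangle_count_le:
  assumes "S \<subseteq> V" and "\<And>z. z \<in> S \<Longrightarrow> real (card (nbrs E z)) \<le> b"
    and hit: "\<And>x y z. y \<in> nbrs E x \<Longrightarrow> z \<in> nbrs E x \<Longrightarrow> z \<in> nbrs E y \<Longrightarrow> x \<in> S \<or> y \<in> S \<or> z \<in> S"
  shows "(\<Sum>x\<in>V. \<Sum>y\<in>nbrs E x. real (card (nbrs E x \<inter> nbrs E y))) \<le> 3 * real (card S) * b * real (bk E)"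
proof -
  let ?T = "\<lambda>S. SIGMA x:S. SIGMA y:nbrs E x. nbrs E x \<inter> nbrs E y"
  have finS: "finite S"
    using assms(1) finite_V finite_subset by blast
  then have fin: "finite (?T S)"
    by (intro finite_SigmaI) auto
  have eq: "(\<Sum>x\<in>V. \<Sum>y\<in>nbrs E x. real (card (nbrs E x \<inter> nbrs E y))) = real (card (?T V))"
    by (simp add: card_SigmaI finite_V finite_SigmaI)
  have "?T V \<subseteq> ?T S \<union> ((\<lambda>(y, x, z). (x, y, z)) ` ?T S \<union> (\<lambda>(z, x, y). (x, y, z)) ` ?T S)"
  proof
    fix t assume "t \<in> ?T V"
    then obtain x y z where t: "t = (x, y, z)"
      and adj: "y \<in> nbrs E x" "z \<in> nbrs E x" "z \<in> nbrs E y"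
      by auto
    then have adj': "x \<in> nbrs E y" "x \<in> nbrs E z" "y \<in> nbrs E z"
      using nbrs_sym by fast+
    consider "x \<in> S" | "y \<in> S" | "z \<in> S"
      using hit adj by blast
    then show "t \<in> ?T S \<union> ((\<lambda>(y, x, z). (x, y, z)) ` ?T S \<union> (\<lambda>(z, x, y). (x, y, z)) ` ?T S)"
    proof cases
      case 1
      then show ?thesis using adj t by auto
    next
      case 2
      then have "(y, x, z) \<in> ?T S" using adj adj' by auto
      then show ?thesis unfolding t by (force intro: image_eqI)
    next
      case 3
      then have "(z, x, y) \<in> ?T S" using adj adj' by auto
      then show ?thesis unfolding t by (force intro: image_eqI)
    qed
  qed
  from this have le: "card (?T V) \<le> card (?T S \<union> ((\<lambda>(y, x, z). (x, y, z)) ` ?T S \<union> (\<lambda>(z, x, y). (x, y, z)) ` ?T S))"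
    by (intro card_mono) (use fin in auto)
  note le
  also have "card (?T S \<union> ((\<lambda>(y, x, z). (x, y, z)) ` ?T S \<union> (\<lambda>(z, x, y). (x, y, z)) ` ?T S))
      \<le> card (?T S) + (card ((\<lambda>(y, x, z). (x, y, z)) ` ?T S) + card ((\<lambda>(z, x, y). (x, y, z)) ` ?T S))"
    by (meson add_left_mono card_Un_le order_trans)
  also have "\<dots> \<le> card (?T S) + (card (?T S) + card (?T S))"
    by (intro add_mono card_image_le fin order_refl)
  finally have "real (card (?T V)) \<le> 3 * real (card (?T S))"
    by linarith
  also have "\<dots> \<le> 3 * (real (card S) * b * real (bk E))"
    using card_triangles_through[OF assms(1,2)] by simp
  finally show ?thesis
    unfolding eq by simp
qed

lemma bk_lower_bound:
  fixes \<phi> :: real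
  defines "n \<equiv> real (card V)" and "q \<equiv> real (bk E)"
  assumes covered: "\<And>x y. y \<in> nbrs E x \<Longrightarrow> nbrs E x \<inter> nbrs E y \<noteq> {}"
    and edges: "n\<^sup>2 / 4 - n * \<phi> \<le> real (card E)"
    and "0 < \<phi>" and \<phi>: "2000 * \<phi> \<le> n" and q: "100 * q \<le> n"
  shows "n\<^sup>2 \<le> 2500 * \<phi> * q\<^sup>2 + 62500 * \<phi>\<^sup>2 * q"
proof -
  let ?d = "\<lambda>x. real (card (nbrs E x))"
  let ?u = "\<lambda>x y. real (card (V - (nbrs E x \<union> nbrs E y)))"
  define S where "S = {x \<in> V. 5 * ?d x \<le> 2 * n}"
  define s where "s = real (card S)"
  define P where "P = (\<Sum>x\<in>V. \<Sum>y\<in>nbrs E x. ?u x y)"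
  define Q where "Q = (\<Sum>x\<in>V. (?d x - n / 2)\<^sup>2)"
  define C where "C = (\<Sum>x\<in>V. \<Sum>y\<in>nbrs E x. real (card (nbrs E x \<inter> nbrs E y)))"
  define A where "A = (SIGMA x:V. nbrs E x)"
  have n: "0 < n"
    using \<open>0 < \<phi>\<close> \<phi> by linarith
  have q0: "0 \<le> q"
    by (simp add: q_def)
  have finS: "finite S"
    using finite_V by (simp add: S_def)
  have finA: "finite A"
    using finite_V by (auto simp: A_def)
  have S_deg: "?d z \<le> 2 / 5 * n" if "z \<in> S" for z
    using that by (simp add: S_def)
  \<comment> \<open>Three degrees above \<open>2 * n / 5\<close> would sum to more than
    \<open>6 * n / 5\<close>, whereas \<open>n + 3 * q\<close> is at most
    \<open>103 * n / 100\<close>.\<close>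
  have hit: "x \<in> S \<or> y \<in> S \<or> z \<in> S"
    if "y \<in> nbrs E x" "z \<in> nbrs E x" "z \<in> nbrs E y" for x y z
  proof (rule ccontr)
    assume "\<not> ?thesis"
    then have "2 * n < 5 * ?d x" "2 * n < 5 * ?d y" "2 * n < 5 * ?d z"
      using that nbrs_in_V by (auto simp: S_def)
    moreover have "?d x + ?d y + ?d z \<le> n + 3 * q"
      using degree_sum_triangle[OF that] unfolding n_def q_def by linarith
    ultimately show False
      using q n by linarith
  qed
  have C: "C \<le> 3 * s * (2 / 5 * n) * q"
    unfolding C_def s_def q_def
    by (rule triangle_count_le) (use S_deg hit in \<open>auto simp: S_def\<close>)
  have "s * n * (100 * q) \<le> s * n * n"
    using q n by (intro mult_left_mono) (auto simp: s_def)
  then have C': "C \<le> 12 / 1000 * (s * n\<^sup>2)"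
    using C by (simp add: power2_eq_square)
  \<comment> \<open>Degrees in \<open>S\<close> fall short of \<open>n / 2\<close> by at least
    \<open>n / 10\<close>, so \<open>S\<close> alone contributes this much to
    \<open>Q\<close>.\<close>
  have "s * (n / 10)\<^sup>2 = (\<Sum>x\<in>S. (n / 10)\<^sup>2)"
    by (simp add: s_def)
  also have "\<dots> \<le> (\<Sum>x\<in>S. (?d x - n / 2)\<^sup>2)"
  proof (rule sum_mono)
    fix x assume "x \<in> S"
    then have "(n / 10)\<^sup>2 \<le> (n / 2 - ?d x)\<^sup>2"
      using S_deg[of x] n by (intro power_mono) auto
    then show "(n / 10)\<^sup>2 \<le> (?d x - n / 2)\<^sup>2"
      by (simp add: power2_commute)
  qed
  also have "\<dots> \<le> Q"
    unfolding Q_def by (rule sum_mono2) (auto simp: S_def finite_V)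
  finally have Q: "s * n\<^sup>2 \<le> 100 * Q"
    by (simp add: power_divide)
  have "P + 2 * Q = n * (n\<^sup>2 / 2 - 2 * real (card E)) + C"
    unfolding P_def Q_def C_def n_def by (rule degree_identity)
  also have "n * (n\<^sup>2 / 2 - 2 * real (card E)) \<le> n * (2 * n * \<phi>)"
    using edges n by (intro mult_left_mono) auto
  finally have PQ: "P + 2 * Q \<le> 2 * \<phi> * n\<^sup>2 + C"
    by (simp add: power2_eq_square mult_ac)
  have "0 \<le> P"
    unfolding P_def by (intro sum_nonneg) auto
  \<comment> \<open>By \<open>Q\<close>, the term \<open>2 * Q\<close> is at least 20/1000 of
    \<open>s * n^2\<close>, while \<open>C\<close> is at most 12/1000 of it. The surplus of 8/1000
    is bounded by \<open>2 * \<phi> * n^2\<close>, whence 250.\<close>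
  then have "s * n\<^sup>2 \<le> 250 * \<phi> * n\<^sup>2"
    using PQ Q C' by linarith
  then have s: "s \<le> 250 * \<phi>"
    using n by simp
  have "0 \<le> s * n\<^sup>2"
    by (simp add: s_def)
  have P: "P \<le> 5 * \<phi> * n\<^sup>2"
    using PQ Q C' \<open>s * n\<^sup>2 \<le> 250 * \<phi> * n\<^sup>2\<close> \<open>0 \<le> s * n\<^sup>2\<close> by linarith
  \<comment> \<open>\<open>B\<close> collects the ordered edges leaving too many vertices
    undominated. Markov's inequality with threshold \<open>50 * \<phi>\<close> bounds it by a tenth
    of \<open>n^2\<close>.\<close>
  define B where "B = {(x, y) \<in> A. 50 * \<phi> < ?u x y}"
  have "50 * \<phi> * real (card B) = (\<Sum>(x, y)\<in>B. 50 * \<phi>)"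
    by simp
  also have "\<dots> \<le> (\<Sum>(x, y)\<in>B. ?u x y)"
    by (rule sum_mono) (auto simp: B_def)
  also have "\<dots> \<le> (\<Sum>(x, y)\<in>A. ?u x y)"
    by (rule sum_mono2) (auto simp: B_def finA)
  also have "\<dots> = P"
    unfolding A_def P_def by (rule sum.Sigma[symmetric]) (auto simp: finite_V)
  finally have "\<phi> * (10 * real (card B)) \<le> \<phi> * n\<^sup>2"
    using P by simp
  then have B: "10 * real (card B) \<le> n\<^sup>2"
    using \<open>0 < \<phi>\<close> by simp
  define F where "F = (SIGMA x:S. nbrs E x)"
  have "real (card F) = (\<Sum>x\<in>S. ?d x)"
    unfolding F_def by (simp add: card_SigmaI finS)
  also have "\<dots> \<le> (\<Sum>x\<in>S. 2 / 5 * n)"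
    by (rule sum_mono) (rule S_deg)
  also have "\<dots> = s * (2 / 5 * n)"
    by (simp add: s_def)
  also have "\<dots> \<le> n / 8 * (2 / 5 * n)"
    using s \<phi> n by (intro mult_right_mono) auto
  finally have F: "20 * real (card F) \<le> n\<^sup>2"
    by (simp add: power2_eq_square)
  have finF: "finite F"
    using finS by (simp add: F_def)
  have "real (card A) = (\<Sum>x\<in>V. ?d x)"
    unfolding A_def by (simp add: card_SigmaI finite_V)
  also have "\<dots> = 2 * real (card E)"
    using arg_cong[OF handshake, of real] by simp
  finally have A: "real (card A) \<ge> n\<^sup>2 / 2 - 2 * (n * \<phi>)"
    using edges by simp
  have "n * (2000 * \<phi>) \<le> n * n"
    using \<phi> n by (intro mult_left_mono) auto
  then have A': "real (card A) \<ge> 4 / 10 * n\<^sup>2"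
    using A by (simp add: power2_eq_square)
  \<comment> \<open>The typical ordered edges: few undominated vertices and no end in
    \<open>S\<close>. Of at least 4/10 of \<open>n^2\<close>, \<open>B\<close> removes at most 1/10
    and the two orientations of \<open>F\<close> together at most 1/10.\<close>
  define G where "G = A - (B \<union> (F \<union> prod.swap ` F))"
  have "card (B \<union> (F \<union> prod.swap ` F)) \<le> card B + (card F + card (prod.swap ` F))"
    by (meson add_left_mono card_Un_le order_trans)
  also have "\<dots> \<le> card B + (card F + card F)"
    by (intro add_mono card_image_le finF order_refl)
  finally have BF: "card (B \<union> (F \<union> prod.swap ` F)) \<le> card B + (card F + card F)" .
  have finB: "finite B"
    unfolding B_def by (rule finite_subset[OF _ finA]) auto
  have "card A - card (B \<union> (F \<union> prod.swap ` F)) \<le> card G"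
    unfolding G_def using finB finF by (intro diff_card_le_card_Diff) auto
  then have "real (card A) \<le> real (card B) + 2 * real (card F) + real (card G)"
    using BF by linarith
  then have G: "real (card G) \<ge> 2 / 10 * n\<^sup>2"
    using A' B F by linarith
  define L where "L = {z \<in> S. ?d z \<le> 2 * q + 50 * \<phi>}"
  let ?T = "SIGMA z:L. SIGMA x:nbrs E z. nbrs E z \<inter> nbrs E x"
  have finL: "finite L"
    using finS by (simp add: L_def)
  have "G \<subseteq> snd ` ?T"
  proof
    fix p assume "p \<in> G"
    then obtain x y where p: "p = (x, y)" and "(x, y) \<in> G"
      by (cases p) auto
    then have xy: "y \<in> nbrs E x" and u: "?u x y \<le> 50 * \<phi>" and "x \<notin> S" "y \<notin> S"
      using nbrs_sym[of x E y] by (auto simp: G_def A_def B_def F_def image_iff)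
    obtain z where z: "z \<in> nbrs E x" "z \<in> nbrs E y"
      using covered[OF xy] by blast
    then have "z \<in> S"
      using hit[OF xy] \<open>x \<notin> S\<close> \<open>y \<notin> S\<close> by blast
    \<comment> \<open>A neighbour of \<open>z\<close> is adjacent to \<open>x\<close>, adjacent to
      \<open>y\<close>, or undominated by the pair; the first two kinds lie in the books on
      \<open>xz\<close> and \<open>yz\<close>.\<close>
    have "nbrs E z \<subseteq> (nbrs E x \<inter> nbrs E z) \<union> ((nbrs E y \<inter> nbrs E z) \<union> (V - (nbrs E x \<union> nbrs E y)))"
      using nbrs_subset by auto
    then have "card (nbrs E z) \<le> card ((nbrs E x \<inter> nbrs E z) \<union> ((nbrs E y \<inter> nbrs E z) \<union> (V - (nbrs E x \<union> nbrs E y))))"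
      using finite_V by (intro card_mono) auto
    also have "\<dots> \<le> card (nbrs E x \<inter> nbrs E z) + (card (nbrs E y \<inter> nbrs E z) + card (V - (nbrs E x \<union> nbrs E y)))"
      by (meson add_left_mono card_Un_le order_trans)
    finally have "?d z \<le> 2 * q + 50 * \<phi>"
      using card_common_nbrs_le_bk[OF z(1)] card_common_nbrs_le_bk[OF z(2)] u
      unfolding q_def by linarith
    then have "z \<in> L"
      using \<open>z \<in> S\<close> by (simp add: L_def)
    moreover have "x \<in> nbrs E z" "y \<in> nbrs E z"
      using z by (simp_all add: nbrs_sym[of _ E z])
    ultimately have "(z, x, y) \<in> ?T"
      using xy by simp
    then show "p \<in> snd ` ?T"
      unfolding p by force
  qed
  then have "card G \<le> card (snd ` ?T)"
    using finL by (intro card_mono) auto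
  also have "\<dots> \<le> card ?T"
    using finL by (intro card_image_le) auto
  finally have "real (card G) \<le> real (card ?T)"
    by simp
  also have "\<dots> \<le> real (card L) * (2 * q + 50 * \<phi>) * q"
    unfolding q_def
    by (rule card_triangles_through) (auto simp: L_def S_def q_def)
  also have "\<dots> \<le> 250 * \<phi> * (2 * q + 50 * \<phi>) * q"
  proof (intro mult_right_mono)
    have "card L \<le> card S"
      using finS by (intro card_mono) (auto simp: L_def)
    then show "real (card L) \<le> 250 * \<phi>"
      using s by (simp add: s_def)
  qed (use q0 \<open>0 < \<phi>\<close> in auto)
  finally have "2 / 10 * n\<^sup>2 \<le> 250 * \<phi> * (2 * q + 50 * \<phi>) * q"
    using G by linarith
  then show ?thesis
    by (simp add: algebra_simps power2_eq_square)
qed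

end

section \<open>The hub graph and its books, triangles and edges\<close>

lemma card_residue_class_le: "card {z::nat. z < N \<and> z mod m = r} \<le> N div m + 1"
proof -
  have "card {z. z < N \<and> z mod m = r} \<le> card {..N div m}"
  proof (rule card_inj_on_le)
    show "inj_on (\<lambda>z. z div m) {z. z < N \<and> z mod m = r}"
      by (rule inj_onI) (metis (mono_tags, lifting) div_mult_mod_eq mem_Collect_eq)
  qed (auto intro: div_le_mono)
  then show ?thesis
    by simp
qed

text \<open>
  The sides of the bipartite graph are the even and the odd numbers below \<open>N\<close>, their classes are
  residue classes modulo \<open>2 * k\<close>, and \<open>N + k * i + j\<close> is the hub of the pair \<open>(i, j)\<close>.
\<close>

definition hub_graph :: "nat \<Rightarrow> nat \<Rightarrow> nat set set" where
  "hub_graph k N = {{u, v} |u v. u < N \<and> v < N \<and> odd (u + v)} \<union>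
     {{u, N + k * i + j} |u i j. u < N \<and> i < k \<and> j < k \<and> (u mod (2 * k) = 2 * i \<or> u mod (2 * k) = 2 * j + 1)}"

text \<open>Uniqueness of quotient and remainder modulo \<open>k\<close>: distinct pairs of classes
  get distinct hubs.\<close>

lemma hub_eq_iff:
  fixes i i' j j' k N :: nat
  assumes "j < k" "j' < k"
  shows "N + k * i + j = N + k * i' + j' \<longleftrightarrow> i = i' \<and> j = j'"
proof
  assume "N + k * i + j = N + k * i' + j'"
  then have eq: "k * i + j = k * i' + j'"
    by simp
  have "(k * i + j) div k = i" "(k * i' + j') div k = i'"
    using assms by auto
  then show "i = i' \<and> j = j'"
    using eq by auto
qed auto

lemma hub_graph_cases:
  assumes "{x, y} \<in> hub_graph k N"
  obtains (cross) "x < N" "y < N" "odd (x + y)"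
  | (hub) i j where "x < N" "i < k" "j < k" "y = N + k * i + j" "x mod (2 * k) = 2 * i \<or> x mod (2 * k) = 2 * j + 1"
  | (hub') i j where "y < N" "i < k" "j < k" "x = N + k * i + j" "y mod (2 * k) = 2 * i \<or> y mod (2 * k) = 2 * j + 1"
  using assms unfolding hub_graph_def by (auto simp: doubleton_eq_iff add.commute)

lemma hub_graph_hubI:
  assumes "u < N" "i < k" "j < k" "u mod (2 * k) = 2 * i \<or> u mod (2 * k) = 2 * j + 1"
  shows "N + k * i + j \<in> nbrs (hub_graph k N) u"
  using assms unfolding hub_graph_def nbrs_def by blast

lemma simple_graph_hub_graph: "simple_graph {..<N + k\<^sup>2} (hub_graph k N)"
proof -
  have "k * i + j < k\<^sup>2" if "i < k" "j < k" for i j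
  proof -
    have "k * i + j < k * (i + 1)"
      using that by simp
    also have "\<dots> \<le> k * k"
      using that by (intro mult_le_mono) auto
    finally show ?thesis
      by (simp add: power2_eq_square)
  qed
  then show ?thesis
    unfolding simple_graph_def hub_graph_def
    by (auto simp: card_insert_if trans_less_add1 add.assoc)
qed

text \<open>The modulus is even, so residues \<open>2 * i\<close> occur only on the even side and
  residues \<open>2 * j + 1\<close> only on the odd side.\<close>

lemma even_mod_double: "even (u mod (2 * k)) \<longleftrightarrow> even u" for u k :: nat
  by (simp add: dvd_mod_iff)

text \<open>A common neighbour below \<open>N\<close> would need parity opposite to both ends. For a
  hub, the class of \<open>x\<close> fixes the first index and that of \<open>y\<close> the
  second.\<close>

lemma hub_graph_common_nbrs_cross:
  assumes "x < N" "y < N" "even x" "odd y"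
  shows "nbrs (hub_graph k N) x \<inter> nbrs (hub_graph k N) y \<subseteq>
    {N + k * (x mod (2 * k) div 2) + y mod (2 * k) div 2}"
proof
  fix z assume z: "z \<in> nbrs (hub_graph k N) x \<inter> nbrs (hub_graph k N) y"
  then have "{x, z} \<in> hub_graph k N" "{y, z} \<in> hub_graph k N"
    by (auto simp: nbrs_def)
  from this(1) show "z \<in> {N + k * (x mod (2 * k) div 2) + y mod (2 * k) div 2}"
  proof (cases rule: hub_graph_cases)
    case cross
    from \<open>{y, z} \<in> _\<close> show ?thesis
      by (cases rule: hub_graph_cases) (use cross assms in auto)
  next
    case (hub i j)
    have x: "x mod (2 * k) = 2 * i"
      using hub even_mod_double[of x k] assms by auto
    from \<open>{y, z} \<in> _\<close> show ?thesis
    proof (cases rule: hub_graph_cases)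
      case (hub i' j')
      then have "y mod (2 * k) = 2 * j' + 1"
        using even_mod_double[of y k] assms by auto
      moreover have "i' = i \<and> j' = j"
        using hub \<open>z = N + k * i + j\<close> \<open>j < k\<close> hub_eq_iff[of j k j' N i i'] by simp
      ultimately show ?thesis
        using x hub by simp
    qed (use hub assms in auto)
  qed (use assms in auto)
qed

text \<open>Hubs are pairwise nonadjacent, so a common neighbour lies below \<open>N\<close>, on the
  side opposite to \<open>x\<close>, and in the class that the hub serves there.\<close>

lemma hub_graph_common_nbrs_hub:
  assumes "x < N" "i < k" "j < k" "y = N + k * i + j"
    and "x mod (2 * k) = 2 * i \<or> x mod (2 * k) = 2 * j + 1"
  shows "nbrs (hub_graph k N) x \<inter> nbrs (hub_graph k N) y \<subseteq>
    {z. z < N \<and> z mod (2 * k) = (if even x then 2 * j + 1 else 2 * i)}"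
proof
  fix z assume z: "z \<in> nbrs (hub_graph k N) x \<inter> nbrs (hub_graph k N) y"
  then have "{y, z} \<in> hub_graph k N" and xz: "{x, z} \<in> hub_graph k N"
    by (auto simp: nbrs_def)
  from this(1) show "z \<in> {z. z < N \<and> z mod (2 * k) = (if even x then 2 * j + 1 else 2 * i)}"
  proof (cases rule: hub_graph_cases)
    case (hub' i' j')
    have ij: "i' = i \<and> j' = j"
      using hub' assms hub_eq_iff[of j k j' N i i'] by simp
    from xz have "odd (x + z)"
      by (cases rule: hub_graph_cases) (use hub' assms in auto)
    then show ?thesis
      using hub' ij even_mod_double[of z k] by auto
  qed (use assms in auto)
qed

lemma card_hub_graph_common_nbrs_hub:
  assumes "x < N" "i < k" "j < k" "y = N + k * i + j"
    and "x mod (2 * k) = 2 * i \<or> x mod (2 * k) = 2 * j + 1"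
  shows "card (nbrs (hub_graph k N) x \<inter> nbrs (hub_graph k N) y) \<le> N div (2 * k) + 1"
proof -
  have "card (nbrs (hub_graph k N) x \<inter> nbrs (hub_graph k N) y) \<le>
      card {z. z < N \<and> z mod (2 * k) = (if even x then 2 * j + 1 else 2 * i)}"
    by (intro card_mono hub_graph_common_nbrs_hub assms) simp
  also have "\<dots> \<le> N div (2 * k) + 1"
    by (rule card_residue_class_le)
  finally show ?thesis .
qed

text \<open>A cross edge lies in at most one triangle; the book on a hub edge fits into one residue
  class modulo \<open>2 * k\<close>.\<close>

lemma bk_hub_graph_le: "bk (hub_graph k N) \<le> N div (2 * k) + 1"
proof (rule bk_le[OF simple_graph_hub_graph])
  fix x y assume "y \<in> nbrs (hub_graph k N) x"
  then have "{x, y} \<in> hub_graph k N"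
    by (simp add: nbrs_def)
  then show "card (nbrs (hub_graph k N) x \<inter> nbrs (hub_graph k N) y) \<le> N div (2 * k) + 1"
  proof (cases rule: hub_graph_cases)
    case cross
    have "\<exists>w. nbrs (hub_graph k N) x \<inter> nbrs (hub_graph k N) y \<subseteq> {w}"
    proof (cases "even x")
      case True
      then show ?thesis
        using hub_graph_common_nbrs_cross[of x N y k] cross by auto
    next
      case False
      then show ?thesis
        using hub_graph_common_nbrs_cross[of y N x k] cross by (auto simp: Int_commute)
    qed
    then have "card (nbrs (hub_graph k N) x \<inter> nbrs (hub_graph k N) y) \<le> 1"
      by (auto dest: card_mono[rotated])
    then show ?thesis
      by simp
  next
    case (hub i j)
    then show ?thesis
      by (rule card_hub_graph_common_nbrs_hub)
  next
    case (hub' i j)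
    then show ?thesis
      by (subst Int_commute) (rule card_hub_graph_common_nbrs_hub)
  qed
qed

lemma hub_graph_covered:
  assumes "0 < k" "2 * k \<le> N" "{x, y} \<in> hub_graph k N"
  shows "nbrs (hub_graph k N) x \<inter> nbrs (hub_graph k N) y \<noteq> {}"
proof -
  have even_odd: "nbrs (hub_graph k N) x \<inter> nbrs (hub_graph k N) y \<noteq> {}"
    if "x < N" "y < N" "even x" "odd y" for x y
  proof -
    define i j where "i = x mod (2 * k) div 2" and "j = y mod (2 * k) div 2"
    have "x mod (2 * k) < 2 * k" "y mod (2 * k) < 2 * k"
      using \<open>0 < k\<close> by simp_all
    moreover have "x mod (2 * k) = 2 * i" "y mod (2 * k) = 2 * j + 1"
      using that even_mod_double[of x k] even_mod_double[of y k] by (auto simp: i_def j_def)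
    ultimately have "N + k * i + j \<in> nbrs (hub_graph k N) x" "N + k * i + j \<in> nbrs (hub_graph k N) y"
      using that by (auto intro!: hub_graph_hubI)
    then show ?thesis
      by blast
  qed
  have class_hub: "nbrs (hub_graph k N) x \<inter> nbrs (hub_graph k N) y \<noteq> {}"
    if "x < N" "i < k" "j < k" "y = N + k * i + j"
      "x mod (2 * k) = 2 * i \<or> x mod (2 * k) = 2 * j + 1" for x y i j
  proof -
    \<comment> \<open>The least member of the class that the hub serves on the side opposite to
      \<open>x\<close>. It is below \<open>2 * k\<close>, hence below \<open>N\<close>.\<close>
    define z where "z = (if even x then 2 * j + 1 else 2 * i)"
    have z: "z < N" "odd (x + z)"
      using that assms by (auto simp: z_def)
    have "z mod (2 * k) = z"
      using that by (auto simp: z_def)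
    then have "y \<in> nbrs (hub_graph k N) z"
      unfolding that(4) using that z by (intro hub_graph_hubI) (auto simp: z_def)
    moreover have "z \<in> nbrs (hub_graph k N) x"
      unfolding nbrs_def hub_graph_def using that z by blast
    ultimately show ?thesis
      using nbrs_sym[of z] by blast
  qed
  from assms(3) show ?thesis
  proof (cases rule: hub_graph_cases)
    case cross
    then show ?thesis
      using even_odd[of x y] even_odd[of y x] by auto
  next
    case (hub i j)
    then show ?thesis
      using class_hub by blast
  next
    case (hub' i j)
    then show ?thesis
      using class_hub[of y i j x] by blast
  qed
qed

text \<open>Cross edges alone suffice: even times odd vertices. The extra 1 is the rounding loss for
  odd \<open>N\<close>.\<close>

lemma card_hub_graph_ge: "N\<^sup>2 \<le> 4 * card (hub_graph k N) + 1"
proof -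
  define P where "P = {..<(N + 1) div 2} \<times> {..<N div 2}"
  have "inj_on (\<lambda>(a, b). {2 * a, 2 * b + 1}) P"
    by (auto simp: inj_on_def doubleton_eq_iff) presburger+
  moreover have "(\<lambda>(a, b). {2 * a, 2 * b + 1}) ` P \<subseteq> hub_graph k N"
  proof
    fix e assume "e \<in> (\<lambda>(a, b). {2 * a, 2 * b + 1}) ` P"
    then obtain a b where "e = {2 * a, 2 * b + 1}" "2 * a < N" "2 * b + 1 < N" "odd (2 * a + (2 * b + 1))"
      by (auto simp: P_def)
    then show "e \<in> hub_graph k N"
      unfolding hub_graph_def by blast
  qed
  ultimately have "card P \<le> card (hub_graph k N)"
    by (rule card_inj_on_le) (rule finite_E[OF simple_graph_hub_graph])
  moreover have "N\<^sup>2 \<le> 4 * card P + 1"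
  proof (cases "even N")
    case True
    then obtain m where "N = 2 * m" ..
    then show ?thesis
      by (simp add: P_def power2_eq_square)
  next
    case False
    then obtain m where "N = 2 * m + 1" ..
    then show ?thesis
      by (simp add: P_def power2_eq_square algebra_simps)
  qed
  ultimately show ?thesis
    by linarith
qed

lemma ex_admissible_bk_le:
  assumes "1 \<le> f n" "3 * f n \<le> real n"
  shows "\<exists>V E. admissible n f V E \<and> real (bk E) \<le> 2 * real n / sqrt (f n)"
proof -
  \<comment> \<open>The largest \<open>k\<close> whose \<open>k^2\<close> hubs number at most
    \<open>f n\<close>. Deleting \<open>k^2\<close> vertices from the bipartite part costs about
    \<open>n * k^2 / 2\<close> edges, within the allowance \<open>n * f n\<close>.\<close>
  define k where "k = nat \<lfloor>sqrt (f n)\<rfloor>"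
  have sqrt1: "1 \<le> sqrt (f n)"
    using assms by simp
  have k: "1 \<le> k" "real k \<le> sqrt (f n)" "sqrt (f n) < real k + 1"
    using sqrt1 by (auto simp: k_def le_nat_iff)
  have kf: "(real k)\<^sup>2 \<le> f n"
    using power_mono[OF k(2), of 2] assms by simp
  have "k \<le> k\<^sup>2"
    using k by (simp add: power2_eq_square)
  have "real (3 * k\<^sup>2) \<le> real n"
    using kf assms by simp
  then have k3: "3 * k\<^sup>2 \<le> n"
    by linarith
  define N where "N = n - k\<^sup>2"
  have n: "n = N + k\<^sup>2"
    using k3 by (simp add: N_def)
  have kN: "2 * k \<le> N"
    using k3 \<open>k \<le> k\<^sup>2\<close> by (simp add: N_def)
  let ?E = "hub_graph k N"
  note graph = simple_graph_hub_graph[of N k, folded n]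
  have "triangles_on ?E e \<noteq> {}" if "e \<in> ?E" for e
  proof -
    have "card e = 2"
      using graph that by (auto simp: simple_graph_def)
    then obtain x y where e: "e = {x, y}"
      by (auto simp: card_2_iff)
    then show ?thesis
      using triangles_on_eq[OF graph, of x y] hub_graph_covered[of k N x y] k kN that by simp
  qed
  moreover have "\<lceil>(real n)\<^sup>2 / 4 - real n * f n\<rceil> \<le> int (card ?E)"
  proof -
    have "real N = real n - (real k)\<^sup>2"
      by (simp add: n)
    then have "(real N)\<^sup>2 = (real n)\<^sup>2 - 2 * (real n * (real k)\<^sup>2) + ((real k)\<^sup>2)\<^sup>2"
      by (simp add: power2_diff)
    moreover have "real n * (real k)\<^sup>2 \<le> real n * f n"
      by (intro mult_left_mono kf) simp
    \<comment> \<open>Leaves room for the rounding loss in \<open>card_hub_graph_ge\<close>.\<close>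
    moreover have "1 * 1 \<le> real n * f n"
      using assms by (intro mult_mono) auto
    moreover have "real (N\<^sup>2) \<le> real (4 * card ?E + 1)"
      using card_hub_graph_ge[of N k] by (simp only: of_nat_le_iff)
    then have "(real N)\<^sup>2 \<le> 4 * real (card ?E) + 1"
      by simp
    moreover have "0 \<le> ((real k)\<^sup>2)\<^sup>2"
      by simp
    ultimately have "(real n)\<^sup>2 / 4 - real n * f n \<le> real (card ?E)"
      by linarith
    then show ?thesis
      by (simp add: ceiling_le_iff)
  qed
  ultimately have "admissible n f {..<n} ?E"
    using graph by (simp add: admissible_def)
  moreover have "real (bk ?E) \<le> 2 * real n / sqrt (f n)"
  proof -
    have "real (bk ?E) \<le> real (N div (2 * k)) + 1"
      using bk_hub_graph_le[of k N] by linarith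
    also have "real (N div (2 * k)) \<le> real N / real (2 * k)"
      using of_nat_div_le_of_nat[of N "2 * k", where 'a = real] by simp
    also have "\<dots> \<le> real n / sqrt (f n)"
    proof (rule frac_le)
      show "sqrt (f n) \<le> real (2 * k)"
        using k by linarith
    qed (use sqrt1 n in auto)
    \<comment> \<open>Absorbs the additive 1 of the book bound, giving the factor 2.\<close>
    also have "1 \<le> real n / sqrt (f n)"
    proof -
      have "sqrt (f n) * 1 \<le> sqrt (f n) * sqrt (f n)"
        using sqrt1 by (intro mult_left_mono) auto
      then show ?thesis
        using assms by (simp add: le_divide_eq)
    qed
    finally show ?thesis
      by simp
  qed
  ultimately show ?thesis
    by blast
qed

section \<open>Bounds on \<open>gamma\<close> and their asymptotic form\<close>

lemma gamma_le:
  assumes "admissible n f V E"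
  shows "gamma n f \<le> bk E"
  unfolding gamma_def by (rule Least_le) (use assms in blast)

text \<open>The \<open>LEAST\<close> in \<open>gamma\<close> is only meaningful once some admissible
  graph exists; the hub graph will supply one.\<close>

lemma gamma_attained:
  assumes "admissible n f V E"
  obtains V' E' where "admissible n f V' E'" "bk E' = gamma n f"
proof -
  have "\<exists>V E. admissible n f V E \<and> bk E = gamma n f"
    unfolding gamma_def by (rule LeastI_ex) (use assms in blast)
  then show ?thesis
    using that by blast
qed

lemma gamma_upper:
  assumes "1 \<le> f n" "3 * f n \<le> real n"
  shows "real (gamma n f) \<le> 2 * real n / sqrt (f n)"
proof -
  obtain V E where "admissible n f V E" "real (bk E) \<le> 2 * real n / sqrt (f n)"
    using ex_admissible_bk_le[of f n] assms by blast
  then show ?thesis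
    using gamma_le[of n f V E] by linarith
qed

text \<open>The first case is failure of the size hypothesis of \<open>bk_lower_bound\<close>.
  Otherwise one of the two summands there is at least half of \<open>n^2\<close>, which doubles its
  constant.\<close>

lemma gamma_lower:
  assumes "1 \<le> f n" "2000 * f n \<le> real n"
  shows "real n < 100 * real (gamma n f) \<or>
    (real n)\<^sup>2 \<le> 5000 * f n * (real (gamma n f))\<^sup>2 \<or>
    (real n)\<^sup>2 \<le> 125000 * (f n)\<^sup>2 * real (gamma n f)"
proof -
  obtain V E where adm: "admissible n f V E" and bk: "bk E = gamma n f"
    using ex_admissible_bk_le[of f n] assms by (auto elim: gamma_attained)
  have graph: "simple_graph V E" and n: "card V = n"
    using adm by (auto simp: admissible_def)
  have "(real n)\<^sup>2 / 4 - real n * f n \<le> real (card E)"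
    using adm by (simp add: admissible_def ceiling_le_iff)
  moreover have "nbrs E x \<inter> nbrs E y \<noteq> {}" if "y \<in> nbrs E x" for x y
    using adm that triangles_on_eq[OF graph, of x y] by (auto simp: admissible_def nbrs_def)
  ultimately have "(real n)\<^sup>2 \<le> 2500 * f n * (real (gamma n f))\<^sup>2 + 62500 * (f n)\<^sup>2 * real (gamma n f)"
    if "100 * real (gamma n f) \<le> real n"
    using bk_lower_bound[OF graph, of "f n"] assms that unfolding n bk by simp
  then show ?thesis
    by linarith
qed

text \<open>With \<open>F\<close> of order at most \<open>x powr c\<close>, the three alternatives
  give \<open>q\<close> of order at least \<open>x\<close>, \<open>x powr (1 - c / 2)\<close> and
  \<open>x powr (2 - 2 * c)\<close>. Taking \<open>e\<close> below all three exponents and the least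
  of the constants covers every case.\<close>

lemma lower_bound_powr:
  fixes b c e x q F :: real
  assumes b: "0 < b" and x: "1 \<le> x" and q: "0 \<le> q" and F: "0 \<le> F" "F \<le> b * x powr c"
    and e: "e \<le> 1" "e \<le> 1 - c / 2" "e \<le> 2 - 2 * c"
    and disj: "x < 100 * q \<or> x\<^sup>2 \<le> 5000 * F * q\<^sup>2 \<or> x\<^sup>2 \<le> 125000 * F\<^sup>2 * q"
  shows "min (1 / 100) (min (1 / sqrt (5000 * b)) (1 / (125000 * b\<^sup>2))) * x powr e \<le> q"
    (is "?K * _ \<le> _")
proof -
  have K: "?K \<le> 1 / 100" "?K \<le> 1 / sqrt (5000 * b)" "?K \<le> 1 / (125000 * b\<^sup>2)"
    by simp_all
  from disj consider "x < 100 * q" | "x\<^sup>2 \<le> 5000 * F * q\<^sup>2" | "x\<^sup>2 \<le> 125000 * F\<^sup>2 * q"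
    by blast
  then show ?thesis
  proof cases
    case 1
    have "?K * x powr e \<le> 1 / 100 * x powr 1"
      using K x e by (intro mult_mono powr_mono) auto
    then show ?thesis
      using 1 x by simp
  next
    case 2
    have "x\<^sup>2 \<le> 5000 * (b * x powr c) * q\<^sup>2"
      using 2 F by (elim order_trans) (intro mult_right_mono mult_left_mono, auto)
    moreover have "(x powr (1 - c / 2))\<^sup>2 = x\<^sup>2 / x powr c"
    proof -
      have "(x powr (c / 2))\<^sup>2 = x powr c"
        by (simp add: power2_eq_square flip: powr_add)
      then show ?thesis
        using x by (simp add: powr_diff power_divide)
    qed
    ultimately have "(x powr (1 - c / 2))\<^sup>2 \<le> 5000 * b * q\<^sup>2"
      using x by (simp add: divide_le_eq mult_ac)
    then have "x powr (1 - c / 2) \<le> sqrt (5000 * b * q\<^sup>2)"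
      by (rule real_le_rsqrt)
    also have "\<dots> = sqrt (5000 * b) * q"
      using q by (simp add: real_sqrt_mult)
    finally have *: "1 / sqrt (5000 * b) * x powr (1 - c / 2) \<le> q"
      using b by (simp add: divide_le_eq mult_ac)
    have "?K * x powr e \<le> 1 / sqrt (5000 * b) * x powr (1 - c / 2)"
      using K x e b by (intro mult_mono powr_mono) auto
    then show ?thesis
      using * by linarith
  next
    case 3
    have "x\<^sup>2 \<le> 125000 * (b * x powr c)\<^sup>2 * q"
      using 3 F q by (elim order_trans) (intro mult_right_mono mult_left_mono power_mono, auto)
    moreover have "x powr (2 - 2 * c) = x\<^sup>2 / (x powr c)\<^sup>2"
    proof -
      have "(x powr c)\<^sup>2 = x powr (2 * c)"
        by (simp add: power2_eq_square flip: powr_add)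
      then show ?thesis
        using x by (simp add: powr_diff)
    qed
    ultimately have "x powr (2 - 2 * c) \<le> 125000 * b\<^sup>2 * q"
      using x by (simp add: divide_le_eq power_mult_distrib mult_ac)
    then have *: "1 / (125000 * b\<^sup>2) * x powr (2 - 2 * c) \<le> q"
      using b by (simp add: divide_le_eq mult_ac)
    have "?K * x powr e \<le> 1 / (125000 * b\<^sup>2) * x powr (2 - 2 * c)"
      using K x e b by (intro mult_mono powr_mono) auto
    then show ?thesis
      using * by linarith
  qed
qed

theorem corollary1p5:
  fixes c :: real and f :: "nat \<Rightarrow> real"
  assumes "0 < c" and "c < 1"
    and "\<And>n. n \<ge> 1 \<Longrightarrow> f n > 0"
    and "f \<in> \<Theta>(\<lambda>n. real n powr c)"
  shows "(c \<le> 2 / 3 \<longrightarrow> (\<lambda>n. real (gamma n f)) \<in> \<Theta>(\<lambda>n. real n powr (1 - c / 2))) \<and>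
         (c \<ge> 2 / 3 \<longrightarrow> (\<lambda>n. real (gamma n f)) \<in> \<Omega>(\<lambda>n. real n powr (2 - 2 * c)))"
proof -
  have f: "f \<in> O(\<lambda>n. real n powr c)" "f \<in> \<Omega>(\<lambda>n. real n powr c)"
    using assms(4) by (auto simp: bigtheta_def)
  obtain b where b: "0 < b" "\<forall>\<^sub>F n in sequentially. norm (f n) \<le> b * norm (real n powr c)"
    using landau_o.bigE[OF f(1)] by blast
  obtain a where a: "0 < a" "\<forall>\<^sub>F n in sequentially. norm (f n) \<ge> a * norm (real n powr c)"
    using landau_omega.bigE[OF f(2)] by blast
  have "((\<lambda>n. real n powr (- c)) \<longlongrightarrow> 0) sequentially"
    using \<open>0 < c\<close> by (intro tendsto_neg_powr filterlim_real_sequentially) simp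
  then have ev1: "\<forall>\<^sub>F n in sequentially. real n powr (- c) < a"
    using \<open>0 < a\<close> by (rule order_tendstoD)
  have "((\<lambda>n. real n powr (c - 1)) \<longlongrightarrow> 0) sequentially"
    using \<open>c < 1\<close> by (intro tendsto_neg_powr filterlim_real_sequentially) simp
  then have ev2: "\<forall>\<^sub>F n in sequentially. real n powr (c - 1) < 1 / (2000 * b)"
    by (rule order_tendstoD) (use \<open>0 < b\<close> in simp)
  \<comment> \<open>\<open>c > 0\<close> makes \<open>f n\<close> eventually at least 1, and
    \<open>c < 1\<close> makes it a small fraction of \<open>n\<close>.\<close>
  have ev: "\<forall>\<^sub>F n in sequentially. 1 \<le> n \<and> 1 \<le> f n \<and> 2000 * f n \<le> real n \<and>
      a * real n powr c \<le> f n \<and> f n \<le> b * real n powr c"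
    using a(2) b(2) ev1 ev2 eventually_ge_at_top[of 1]
  proof eventually_elim
    case (elim n)
    then have bounds: "a * real n powr c \<le> f n" "f n \<le> b * real n powr c"
      using assms(3)[of n] by auto
    have "1 \<le> a * real n powr c"
      using elim by (simp add: powr_minus_divide divide_less_eq)
    moreover have "2000 * (b * real n powr c) \<le> real n"
      using elim \<open>0 < b\<close> by (simp add: powr_diff field_simps)
    ultimately show ?case
      using bounds elim by auto
  qed
  have lower: "(\<lambda>n. real (gamma n f)) \<in> \<Omega>(\<lambda>n. real n powr e)"
    if "e \<le> 1" "e \<le> 1 - c / 2" "e \<le> 2 - 2 * c" for e
  proof (rule landau_omega.bigI)
    show "0 < min (1 / 100) (min (1 / sqrt (5000 * b)) (1 / (125000 * b\<^sup>2)))" (is "0 < ?K")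
      using \<open>0 < b\<close> by simp
    show "\<forall>\<^sub>F n in sequentially. norm (real (gamma n f)) \<ge> ?K * norm (real n powr e)"
      using ev
    proof eventually_elim
      case (elim n)
      then have "?K * real n powr e \<le> real (gamma n f)"
        using that by (intro lower_bound_powr[OF b(1) _ _ _ _ _ _ _ gamma_lower[of f n]]) auto
      then show ?case
        by simp
    qed
  qed
  have upper: "(\<lambda>n. real (gamma n f)) \<in> O(\<lambda>n. real n powr (1 - c / 2))"
  proof (rule landau_o.bigI)
    show "0 < 2 / sqrt a"
      using \<open>0 < a\<close> by simp
    show "\<forall>\<^sub>F n in sequentially. norm (real (gamma n f)) \<le> 2 / sqrt a * norm (real n powr (1 - c / 2))"
      using ev
    proof eventually_elim
      case (elim n)
      have "real (gamma n f) \<le> 2 * real n / sqrt (f n)"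
        using elim by (intro gamma_upper) auto
      also have "\<dots> \<le> 2 * real n / sqrt (a * real n powr c)"
        using elim \<open>0 < a\<close> by (intro divide_left_mono) auto
      also have "\<dots> = 2 / sqrt a * real n powr (1 - c / 2)"
        using elim by (simp add: real_sqrt_mult powr_diff powr_half_sqrt[symmetric] powr_powr)
      finally show ?case
        by simp
    qed
  qed
  \<comment> \<open>The exponents \<open>1 - c / 2\<close> and \<open>2 - 2 * c\<close> cross at
    \<open>c = 2 / 3\<close>, so each is the smaller one on its own range.\<close>
  show ?thesis
    using upper lower[of "1 - c / 2"] lower[of "2 - 2 * c"] assms(1,2) by (auto simp: bigtheta_def)
qed

end
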